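(* Let $\mathcal{H}$ be a real Hilbert space, let $f\in\Gamma_0(\mathcal{H})$ with $\operatorname{int}\operatorname{dom} f\neq\varnothing$ be Gâteaux differentiable on $\operatorname{int}\operatorname{dom} f$, let $m\ge 1$, and let $\mathcal{S}=\{q_0,q_1,\dots,q_m\}\subseteq\operatorname{int}\operatorname{dom} f$. Suppose that $\overleftarrow{E}_f(\mathcal{S})\neq\varnothing$ and let $x\in\overleftarrow{E}_f(\mathcal{S})$. Set $L=\operatorname{span}\{\nabla f(q_1)-\nabla f(q_0),\dots,\nabla f(q_m)-\nabla f(q_0)\}$. Then the following hold. (i) $\overleftarrow{CC}^{ps}_f(\mathcal{S})=\operatorname{aff}(\nabla f(\mathcal{S}))\cap\overleftarrow{E}_f(\mathcal{S})=\operatorname{aff}(\nabla f(\mathcal{S}))\cap\operatorname{dom} f\cap(x+L^{\perp})$. (ii) Suppose that $P_{\operatorname{aff}(\nabla f(\mathcal{S}))}(x)\in\operatorname{dom} f$ (for example, $\operatorname{aff}(\nabla f(\mathcal{S}))\subseteq\operatorname{dom} f$ or $\operatorname{dom} f=\mathcal{H}$). Then $\overleftarrow{CC}^{ps}_f(\mathcal{S})=\{P_{\operatorname{aff}(\nabla f(\mathcal{S}))}(x)\}$.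
   Context: $\Gamma_0(\mathcal{H})$ is the set of proper closed convex functions $\mathcal{H}\to\,]-\infty,+\infty]$; $\operatorname{aff}$ denotes affine hull; $P_C$ is the Euclidean (Hilbert-norm) projector onto $C$. The Bregman distance is $D_f(x,y)=f(x)-f(y)-\langle\nabla f(y),x-y\rangle$ if $y\in\operatorname{int}\operatorname{dom} f$, and $+\infty$ otherwise. $\overleftarrow{E}_f(\mathcal{S})=\{x\in\operatorname{dom} f:\ D_f(x,q_0)=D_f(x,q_1)=\cdots=D_f(x,q_m)\}$. The backward Bregman pseudo-circumcenter set of $\mathcal{S}$ is $\overleftarrow{CC}^{ps}_f(\mathcal{S})=\operatorname{aff}(\nabla f(\mathcal{S}))\cap\overleftarrow{E}_f(\mathcal{S})$. *)

theory Defs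
  imports "HOL-Analysis.Analysis"
begin

(* Functions into ]-\<infinity>, +\<infinity>] have type 'a \<Rightarrow> ereal; the value -\<infinity> is excluded by proper_fun. *)

definition edom :: "('a \<Rightarrow> ereal) \<Rightarrow> 'a set" where
  "edom f = {x. f x < \<infinity>}"

definition eepigraph :: "('a \<Rightarrow> ereal) \<Rightarrow> ('a \<times> real) set" where
  "eepigraph f = {(x, r). f x \<le> ereal r}"

definition proper_fun :: "('a \<Rightarrow> ereal) \<Rightarrow> bool" where
  "proper_fun f \<longleftrightarrow> (\<forall>x. f x \<noteq> -\<infinity>) \<and> edom f \<noteq> {}"

definition Gamma0 :: "('a::real_inner \<Rightarrow> ereal) set" where
  "Gamma0 = {f. proper_fun f \<and> closed (eepigraph f) \<and> convex (eepigraph f)}"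

definition has_gateaux_derivative ::
    "('a::real_inner \<Rightarrow> ereal) \<Rightarrow> ('a \<Rightarrow> real) \<Rightarrow> 'a \<Rightarrow> bool" where
  "has_gateaux_derivative f D y \<longleftrightarrow> bounded_linear D \<and>
     (\<forall>h. ((\<lambda>t::real. (f (y + t *\<^sub>R h) - f y) / ereal t) \<longlongrightarrow> ereal (D h)) (at 0))"

definition gateaux_differentiable_on ::
    "('a::real_inner \<Rightarrow> ereal) \<Rightarrow> 'a set \<Rightarrow> bool" where
  "gateaux_differentiable_on f A \<longleftrightarrow> (\<forall>y\<in>A. \<exists>D. has_gateaux_derivative f D y)"

(* The Riesz representer of the Gateaux derivative; in a Hilbert space it exists, and is
   unique, wherever f is Gateaux differentiable. *)
definition gradient :: "('a::real_inner \<Rightarrow> ereal) \<Rightarrow> 'a \<Rightarrow> 'a" where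
  "gradient f y = (THE u. has_gateaux_derivative f (\<lambda>h. u \<bullet> h) y)"

definition bregman :: "('a::real_inner \<Rightarrow> ereal) \<Rightarrow> 'a \<Rightarrow> 'a \<Rightarrow> ereal" where
  "bregman f x y =
     (if y \<in> interior (edom f) then f x - f y - ereal (gradient f y \<bullet> (x - y)) else \<infinity>)"

definition backward_E :: "('a::real_inner \<Rightarrow> ereal) \<Rightarrow> 'a set \<Rightarrow> 'a set" where
  "backward_E f S = {x \<in> edom f. \<forall>p\<in>S. \<forall>q\<in>S. bregman f x p = bregman f x q}"

definition backward_CCps :: "('a::real_inner \<Rightarrow> ereal) \<Rightarrow> 'a set \<Rightarrow> 'a set" where
  "backward_CCps f S = affine hull (gradient f ` S) \<inter> backward_E f S"

(* The projector onto C. The library's closest_point requires a Heine-Borel type, hence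
   excludes infinite-dimensional Hilbert spaces. *)
definition proj :: "'a::real_inner set \<Rightarrow> 'a \<Rightarrow> 'a" where
  "proj C x = (THE p. p \<in> C \<and> (\<forall>c\<in>C. dist x p \<le> dist x c))"

end

theory Submission
  imports Defs
begin

text \<open>
  For a point of the domain all Bregman distances to \<open>S\<close> are finite, and the difference of
  two of them is affine in that point, with the difference of the two gradients as slope. Hence, once
  \<open>x\<close> equalizes the distances, another point \<open>z\<close> of the domain does so exactly when \<open>z - x\<close> is
  orthogonal to \<open>L\<close>. Since \<open>L\<close> is the direction of the affine hull of the gradients, the foot of
  the perpendicular from \<open>x\<close> is the only point of that hull in \<open>x + L\<^sup>\<bottom>\<close>.
\<close>

text \<open>Gram-Schmidt, one generator at a time: the projection onto the larger span is the old
  one plus a component along the part of the new generator orthogonal to the old span. Later it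
  supplies the foot of the perpendicular.\<close>

lemma ex_orthogonal_decomposition_finite_span:
  fixes x :: "'a::real_inner"
  assumes "finite B"
  shows "\<exists>y\<in>span B. \<forall>b\<in>span B. (x - y) \<bullet> b = 0"
  using assms
proof (induction B arbitrary: x rule: finite_induct)
  case empty
  then show ?case by simp
next
  case (insert a B)
  obtain u where u: "u \<in> span B" "\<forall>b\<in>span B. (a - u) \<bullet> b = 0"
    using insert.IH by blast
  obtain v where v: "v \<in> span B" "\<forall>b\<in>span B. (x - v) \<bullet> b = 0"
    using insert.IH by blast
  \<comment> \<open>\<open>e\<close> is the residual of \<open>a\<close> after projection onto
    \<open>span B\<close>; \<open>c\<close> is the Fourier coefficient of \<open>x\<close> along
    \<open>e\<close>.\<close>
  define e where "e = a - u"
  define c where "c = (x \<bullet> e) / (e \<bullet> e)"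
  define y where "y = v + c *\<^sub>R e"
  have B_sub: "span B \<subseteq> span (insert a B)"
    by (simp add: span_mono subset_insertI)
  have "e \<in> span (insert a B)"
    unfolding e_def using u(1) B_sub by (auto intro: span_diff span_base)
  then have "y \<in> span (insert a B)"
    unfolding y_def using v(1) B_sub by (auto intro: span_add span_scale)
  moreover have ortho_B: "(x - y) \<bullet> b = 0" if "b \<in> span B" for b
    using u(2) v(2) that by (simp add: y_def e_def inner_diff_left inner_add_left)
  have "v \<bullet> e = 0"
    using u(2) v(1) by (simp add: e_def inner_commute)
  \<comment> \<open>For \<open>e = 0\<close> the coefficient \<open>c\<close> is \<open>0\<close>, and the claim still holds.\<close>
  then have ortho_e: "(x - y) \<bullet> e = 0"
    by (cases "e = 0") (simp_all add: y_def c_def inner_diff_left inner_add_left)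
  \<comment> \<open>Since \<open>a = e + u\<close>, orthogonality to \<open>e\<close> and to
    \<open>span B\<close> gives orthogonality to \<open>a\<close>, hence to every \<open>b\<close>
    in the larger span.\<close>
  have "(x - y) \<bullet> b = 0" if "b \<in> span (insert a B)" for b
  proof -
    obtain k where k: "b - k *\<^sub>R a \<in> span B"
      using \<open>b \<in> span (insert a B)\<close> by (auto simp: span_breakdown_eq)
    have "(x - y) \<bullet> a = 0"
      using ortho_e ortho_B[OF u(1)] by (simp add: e_def inner_diff_right)
    then show ?thesis
      using ortho_B[OF k] by (simp add: inner_diff_right)
  qed
  ultimately show ?case by blast
qed

text \<open>By Pythagoras, moving from \<open>p\<close> to \<open>c\<close> inside \<open>C\<close>
  raises the squared distance to \<open>x\<close> by exactly the squared distance from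
  \<open>p\<close> to \<open>c\<close>. So \<open>p\<close> is a minimizer and the only one, as the
  definite description in \<open>proj\<close> demands.\<close>

lemma proj_eqI:
  assumes "p \<in> C" and ortho: "\<And>c. c \<in> C \<Longrightarrow> (x - p) \<bullet> (c - p) = 0"
  shows "proj C x = p"
proof -
  have pyth: "(dist x c)\<^sup>2 = (dist x p)\<^sup>2 + (dist p c)\<^sup>2" if "c \<in> C" for c
  proof -
    have "x - c = (x - p) - (c - p)" by simp
    then have "(norm (x - c))\<^sup>2 = (norm (x - p))\<^sup>2 + (norm (c - p))\<^sup>2"
      using ortho[OF that]
      by (simp only: power2_norm_eq_inner) (simp add: inner_diff_left inner_diff_right inner_commute)
    then show ?thesis by (simp add: dist_norm norm_minus_commute)
  qed
  show ?thesis
    unfolding proj_def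
  proof (rule the_equality)
    have "dist x p \<le> dist x c" if "c \<in> C" for c
      by (rule power2_le_imp_le) (use pyth[OF that] in auto)
    then show "p \<in> C \<and> (\<forall>c\<in>C. dist x p \<le> dist x c)"
      using \<open>p \<in> C\<close> by blast
  next
    fix r assume r: "r \<in> C \<and> (\<forall>c\<in>C. dist x r \<le> dist x c)"
    then have "(dist x r)\<^sup>2 \<le> (dist x p)\<^sup>2"
      using \<open>p \<in> C\<close> by (intro power_mono) auto
    then have "(dist p r)\<^sup>2 \<le> 0"
      using pyth[of r] r by linarith
    then show "r = p" by simp
  qed
qed

lemma affine_hull_image_eq_span:
  fixes g :: "nat \<Rightarrow> 'a::real_vector"
  shows "affine hull (g ` {0..m}) = (\<lambda>v. g 0 + v) ` span ((\<lambda>i. g i - g 0) ` {1..m})"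
proof -
  \<comment> \<open>Index \<open>0\<close> contributes only the zero vector, which does not change
    the span.\<close>
  have "span ((\<lambda>y. - g 0 + y) ` (g ` {0..m})) = span (insert 0 ((\<lambda>i. g i - g 0) ` {1..m}))"
    by (rule arg_cong[of _ _ span]) (force simp: image_iff Suc_le_eq)
  moreover have "affine hull (g ` {0..m}) = (\<lambda>v. g 0 + v) ` span ((\<lambda>y. - g 0 + y) ` (g ` {0..m}))"
    by (rule affine_hull_span_gen) (auto intro: hull_inc)
  ultimately show ?thesis by simp
qed

text \<open>All values of \<open>f\<close> involved are finite, so \<open>f z\<close> cancels and an
  equation in \<open>ereal\<close> becomes one between reals: the linearizations of \<open>f\<close>
  at \<open>p\<close> and at \<open>r\<close> agree at \<open>z\<close>.\<close>

lemma bregman_eq_iff: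
  assumes "proper_fun f" "z \<in> edom f" "p \<in> interior (edom f)" "r \<in> interior (edom f)"
  shows "bregman f z p = bregman f z r \<longleftrightarrow>
    real_of_ereal (f p) + gradient f p \<bullet> (z - p) = real_of_ereal (f r) + gradient f r \<bullet> (z - r)"
proof -
  have fin: "\<exists>c. f y = ereal c" if "y \<in> edom f" for y
    using that assms(1) by (cases "f y") (auto simp: edom_def proper_fun_def)
  obtain a b c where "f z = ereal a" "f p = ereal b" "f r = ereal c"
    using fin[OF assms(2)] fin[OF subsetD[OF interior_subset assms(3)]]
      fin[OF subsetD[OF interior_subset assms(4)]] by blast
  then show ?thesis
    using assms(3,4) by (auto simp: bregman_def)
qed

lemma backward_E_iff_orthogonal:
  assumes "proper_fun f" "S \<subseteq> interior (edom f)" "x \<in> backward_E f S" "q0 \<in> S"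
  shows "z \<in> backward_E f S \<longleftrightarrow>
    z \<in> edom f \<and> (\<forall>p\<in>S. (gradient f p - gradient f q0) \<bullet> (z - x) = 0)"
proof -
  \<comment> \<open>\<open>\<phi> y p\<close> is the linearization of \<open>f\<close> at
    \<open>p\<close>, evaluated at \<open>y\<close>; on the domain the Bregman distance is
    \<open>f y\<close> minus this value.\<close>
  define \<phi> where "\<phi> y p = real_of_ereal (f p) + gradient f p \<bullet> (y - p)" for y p
  have E_iff: "y \<in> backward_E f S \<longleftrightarrow> y \<in> edom f \<and> (\<forall>p\<in>S. \<phi> y p = \<phi> y q0)" for y
  proof -
    have "bregman f y p = bregman f y r \<longleftrightarrow> \<phi> y p = \<phi> y r"
      if "y \<in> edom f" "p \<in> S" "r \<in> S" for p r
      unfolding \<phi>_def using assms(1,2) that by (intro bregman_eq_iff) auto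
    then have "y \<in> backward_E f S \<longleftrightarrow> y \<in> edom f \<and> (\<forall>p\<in>S. \<forall>r\<in>S. \<phi> y p = \<phi> y r)"
      by (auto simp: backward_E_def)
    also have "\<dots> \<longleftrightarrow> y \<in> edom f \<and> (\<forall>p\<in>S. \<phi> y p = \<phi> y q0)"
      using \<open>q0 \<in> S\<close> by metis
    finally show ?thesis .
  qed
  \<comment> \<open>The terms free of the evaluation point cancel between \<open>z\<close> and
    \<open>x\<close>; the bracket for \<open>x\<close> vanishes because \<open>x\<close> equalizes
    the distances.\<close>
  have "\<phi> z p - \<phi> z q0 = (\<phi> x p - \<phi> x q0) + (gradient f p - gradient f q0) \<bullet> (z - x)" for p
    by (simp add: \<phi>_def inner_diff_left inner_diff_right)
  then have "\<phi> z p = \<phi> z q0 \<longleftrightarrow> (gradient f p - gradient f q0) \<bullet> (z - x) = 0" if "p \<in> S" for p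
    using E_iff[of x] assms(3) that by (smt (verit))
  then show ?thesis using E_iff[of z] by blast
qed

lemma mem_orthogonal_comp_span_iff:
  "v \<in> orthogonal_comp (span B) \<longleftrightarrow> (\<forall>b\<in>B. b \<bullet> v = 0)"
  unfolding orthogonal_comp_def orthogonal_def[symmetric]
  using orthogonal_to_span[of _ B v] by (auto simp: span_base orthogonal_commute)

theorem theorem3p12:
  fixes f :: "'a::{real_inner, complete_space} \<Rightarrow> ereal"
    and q :: "nat \<Rightarrow> 'a" and m :: nat and S L :: "'a set" and x :: 'a
  assumes "f \<in> Gamma0"
    and "interior (edom f) \<noteq> {}"
    and "gateaux_differentiable_on f (interior (edom f))"
    and "m \<ge> 1"
    and "S = q ` {0..m}"
    and "S \<subseteq> interior (edom f)"
    and "backward_E f S \<noteq> {}"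
    and "x \<in> backward_E f S"
    and "L = span ((\<lambda>i. gradient f (q i) - gradient f (q 0)) ` {1..m})"
  shows "(backward_CCps f S = affine hull (gradient f ` S) \<inter> backward_E f S
        \<and> affine hull (gradient f ` S) \<inter> backward_E f S
            = affine hull (gradient f ` S) \<inter> edom f \<inter> (\<lambda>v. x + v) ` orthogonal_comp L)
      \<and> (affine hull (gradient f ` S) \<subseteq> edom f \<or> edom f = UNIV
          \<longrightarrow> proj (affine hull (gradient f ` S)) x \<in> edom f)
      \<and> (proj (affine hull (gradient f ` S)) x \<in> edom f
          \<longrightarrow> backward_CCps f S = {proj (affine hull (gradient f ` S)) x})"
proof -
  define g where "g i = gradient f (q i)" for i
  define A where "A = affine hull (gradient f ` S)"
  have L: "L = span ((\<lambda>i. g i - g 0) ` {1..m})"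
    using assms(9) by (simp add: g_def)
  have "gradient f ` S = g ` {0..m}"
    by (simp add: assms(5) g_def image_image)
  then have A: "A = (\<lambda>v. g 0 + v) ` L"
    unfolding A_def L by (simp only: affine_hull_image_eq_span)
  have "proper_fun f" using assms(1) by (simp add: Gamma0_def)
  moreover have "q 0 \<in> S" by (simp add: assms(5))
  \<comment> \<open>The condition for \<open>q 0\<close> itself is trivial, so only the generators
    of \<open>L\<close>, with indices from \<open>1\<close> on, remain.\<close>
  moreover have "(\<forall>p\<in>S. (gradient f p - gradient f (q 0)) \<bullet> v = 0) \<longleftrightarrow> v \<in> orthogonal_comp L" for v
    unfolding L mem_orthogonal_comp_span_iff assms(5) g_def
    by (force simp: Suc_le_eq)
  ultimately have "z \<in> backward_E f S \<longleftrightarrow> z \<in> edom f \<and> z - x \<in> orthogonal_comp L" for z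
    using backward_E_iff_orthogonal assms(6,8) by metis
  moreover have "z - x \<in> M \<longleftrightarrow> z \<in> (\<lambda>v. x + v) ` M" for z and M :: "'a set"
    by (force simp: image_iff algebra_simps)
  ultimately have E: "backward_E f S = edom f \<inter> (\<lambda>v. x + v) ` orthogonal_comp L"
    by blast

  \<comment> \<open>Translating by \<open>- g 0\<close> turns \<open>A\<close> into the subspace
    \<open>L\<close>; projecting there and translating back gives the foot \<open>p\<close>.\<close>
  obtain y where y: "y \<in> L" "\<forall>b\<in>L. (x - g 0 - y) \<bullet> b = 0"
    unfolding L using ex_orthogonal_decomposition_finite_span[of _ "x - g 0"] by blast
  define p where "p = g 0 + y"
  have pA: "p \<in> A" using y(1) by (simp add: A p_def)
  have diff_L: "c - p \<in> L" if "c \<in> A" for c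
    using that y(1) by (auto simp: A p_def L intro: span_diff)
  have p_ortho: "(x - p) \<bullet> b = 0" if "b \<in> L" for b
    using y(2) that by (simp add: p_def algebra_simps)
  have proj: "proj A x = p"
    using pA p_ortho diff_L by (intro proj_eqI) auto
  have foot: "A \<inter> (\<lambda>v. x + v) ` orthogonal_comp L = {p}"
  proof (intro equalityI subsetI)
    fix z assume z: "z \<in> A \<inter> (\<lambda>v. x + v) ` orthogonal_comp L"
    then have "z - p \<in> L" "z - x \<in> orthogonal_comp L"
      using diff_L by auto
    \<comment> \<open>\<open>z - p\<close> lies in \<open>L\<close>, so it is orthogonal to
      \<open>z - x\<close> and to \<open>x - p\<close>, hence to their sum, which is
      \<open>z - p\<close> itself.\<close>
    then have "(z - x) \<bullet> (z - p) = 0" "(x - p) \<bullet> (z - p) = 0"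
      using p_ortho
      by (simp_all add: orthogonal_comp_def orthogonal_def inner_commute[of "z - x" "z - p"])
    then have "(z - p) \<bullet> (z - p) = 0"
      by (simp add: inner_diff_left)
    then show "z \<in> {p}" by simp
  next
    fix z assume "z \<in> {p}"
    moreover have "p - x \<in> orthogonal_comp L"
      unfolding orthogonal_comp_def orthogonal_def
      using p_ortho by (auto simp: inner_commute[of _ "p - x"] inner_diff_left)
    then have "p \<in> (\<lambda>v. x + v) ` orthogonal_comp L"
      by (rule rev_image_eqI) simp
    ultimately show "z \<in> A \<inter> (\<lambda>v. x + v) ` orthogonal_comp L"
      using pA by blast
  qed
  have CC: "backward_CCps f S = A \<inter> backward_E f S"
    by (simp add: backward_CCps_def A_def)
  show ?thesis
    \<comment> \<open>Part (i) is \<open>E\<close> intersected with \<open>A\<close>. For part (ii),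
      \<open>foot\<close> leaves only \<open>p\<close>, which survives the intersection with the
      domain by assumption; in the two example cases \<open>pA\<close> puts \<open>p\<close> in the
      domain.\<close>
    unfolding A_def[symmetric] proj CC using E foot pA by blast
qed

end
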